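(* Let $n,d\ge 1$ be integers with $n>d+1$. Then there exist weight matrices $W_{rel}^{Q},W_{rel}^{K}\in\mathbb{R}^{d\times d}$ and real numbers $b_{-(n-1)},\dots,b_{n-1}$ (relative positional encoding weights) such that there do not exist weight matrices $W_{vanilla}^{Q},W_{vanilla}^{K}\in\mathbb{R}^{d\times d}$ and input row vectors $x_1,\dots,x_n\in\mathbb{R}^d$ satisfying $$\frac{\exp(\alpha_{ij}^{rel})}{\sum_{k=1}^n\exp(\alpha_{ik}^{rel})}=\frac{\exp(\alpha_{ij}^{vanilla})}{\sum_{k=1}^n\exp(\alpha_{ik}^{vanilla})}\qquad\text{for all } i,j\in\{1,\dots,n\},$$ where $$\alpha_{ij}^{rel}=\frac{1}{\sqrt d}(x_iW_{rel}^{Q})(x_jW_{rel}^{K})^{\top}+b_{j-i},\qquad \alpha_{ij}^{vanilla}=\frac{1}{\sqrt d}(x_iW_{vanilla}^{Q})(x_jW_{vanilla}^{K})^{\top}.$$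
   Context: Vectors are row vectors, so $x_iW$ is a row vector in $\mathbb{R}^d$ and $(x_iW)(x_jW')^{\top}$ is a scalar. The single-head setting is considered, so all query/key weight matrices are $d\times d$. The same input vectors $x_1,\dots,x_n$ are used in both $\alpha^{rel}$ and $\alpha^{vanilla}$. *)

theory Defs
  imports "HOL-Analysis.Analysis"
begin

text \<open>
  The dimension \<open>d\<close> is \<open>CARD('d)\<close>. Input vectors are row vectors, hence \<open>x v* W\<close>; the scalar
  \<open>u v\<^sup>T\<close> of two row vectors is the inner product \<open>u \<bullet> v\<close>. Inputs are the values of a function
  on \<open>nat\<close> at the positions \<open>1, \<dots>, n\<close>.
\<close>

definition alpha_vanilla ::
  "real^'d^'d \<Rightarrow> real^'d^'d \<Rightarrow> (nat \<Rightarrow> real^'d) \<Rightarrow> nat \<Rightarrow> nat \<Rightarrow> real" where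
  "alpha_vanilla WQ WK x i j =
     1 / sqrt (real CARD('d)) * ((x i v* WQ) \<bullet> (x j v* WK))"

text \<open>
  For positions in \<open>{1..n}\<close>, only the values of \<open>b\<close> at the offsets \<open>-(n-1), \<dots>, n-1\<close> are used.
\<close>

definition alpha_rel ::
  "real^'d^'d \<Rightarrow> real^'d^'d \<Rightarrow> (int \<Rightarrow> real) \<Rightarrow> (nat \<Rightarrow> real^'d) \<Rightarrow> nat \<Rightarrow> nat \<Rightarrow> real" where
  "alpha_rel WQ WK b x i j =
     1 / sqrt (real CARD('d)) * ((x i v* WQ) \<bullet> (x j v* WK)) + b (int j - int i)"

definition attention_weight :: "nat \<Rightarrow> (nat \<Rightarrow> nat \<Rightarrow> real) \<Rightarrow> nat \<Rightarrow> nat \<Rightarrow> real" where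
  "attention_weight n \<alpha> i j = exp (\<alpha> i j) / (\<Sum>k=1..n. exp (\<alpha> i k))"

end

theory Submission
  imports Defs
begin

text \<open>
  Take zero relative weight matrices and the encoding \<open>b\<close> with \<open>b 0 = 1\<close> and \<open>b k = 0\<close> otherwise.
  Softmax determines each row of scores up to an additive constant, so equal attention weights make
  the vanilla score matrix the identity plus a constant \<open>c i\<close> in each row \<open>i\<close>. Its \<open>n\<close> key vectors
  satisfy an affine dependence, as \<open>n \<ge> d + 2\<close>; pairing the dependence with the query of row \<open>i\<close>
  cancels \<open>c i\<close> and leaves just the \<open>i\<close>-th coefficient, which is therefore zero for every \<open>i\<close>.
\<close>

text \<open>The logarithm of an attention weight is the score minus the log of the row's normalizer,
  which is independent of \<open>j\<close>; the shift is the difference of the two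
  log-normalizers.\<close>

lemma attention_weight_eq_imp_row_shift:
  fixes n :: nat
  assumes "n > 0"
    and "\<And>j. j \<in> {1..n} \<Longrightarrow> attention_weight n \<alpha> i j = attention_weight n \<beta> i j"
  obtains c where "\<And>j. j \<in> {1..n} \<Longrightarrow> \<beta> i j = \<alpha> i j + c"
proof
  define Z where "Z \<gamma> = (\<Sum>k=1..n. exp (\<gamma> i k))" for \<gamma> :: "nat \<Rightarrow> nat \<Rightarrow> real"
  have Z: "Z \<gamma> > 0" for \<gamma>
    unfolding Z_def using \<open>n > 0\<close> by (intro sum_pos) auto
  fix j assume "j \<in> {1..n}"
  then have "exp (\<alpha> i j) / Z \<alpha> = exp (\<beta> i j) / Z \<beta>"
    using assms(2) by (simp add: attention_weight_def Z_def)
  then have "ln (exp (\<alpha> i j) / Z \<alpha>) = ln (exp (\<beta> i j) / Z \<beta>)"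
    by simp
  then show "\<beta> i j = \<alpha> i j + (ln (Z \<beta>) - ln (Z \<alpha>))"
    using Z[of \<alpha>] Z[of \<beta>] by (simp add: ln_div)
qed

text \<open>The shift \<open>c i\<close> cancels only against coefficients with sum zero, so an
  affine rather than a linear dependence is used; hence the \<open>+ 1\<close>.\<close>

lemma card_le_of_inner_eq_delta_plus_row_shift:
  fixes u v :: "'i \<Rightarrow> 'a::euclidean_space"
  assumes "finite I"
    and inner: "\<And>i j. i \<in> I \<Longrightarrow> j \<in> I \<Longrightarrow> u i \<bullet> v j = (if i = j then 1 else 0) + c i"
  shows "card I \<le> DIM('a) + 1"
proof (rule ccontr)
  assume "\<not> card I \<le> DIM('a) + 1"
  \<comment> \<open>If \<open>v j = v k\<close> with j \<noteq> k, row \<open>j\<close> would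
    contain both \<open>1 + c j\<close> and \<open>c j\<close> as the same inner product.\<close>
  moreover have inj: "inj_on v I"
  proof (rule inj_onI)
    fix j k assume "j \<in> I" "k \<in> I" "v j = v k"
    then show "j = k"
      using inner[of j j] inner[of j k] by (auto split: if_splits)
  qed
  ultimately have "affine_dependent (v ` I)"
    using \<open>finite I\<close> by (intro affine_dependent_biggerset) (auto simp: card_image)
  then obtain U where U: "sum U (v ` I) = 0" "\<exists>w\<in>v ` I. U w \<noteq> 0"
      "(\<Sum>w\<in>v ` I. U w *\<^sub>R w) = 0"
    using \<open>finite I\<close> by (auto simp: affine_dependent_explicit_finite)
  have sum0: "(\<Sum>j\<in>I. U (v j)) = 0" and comb0: "(\<Sum>j\<in>I. U (v j) *\<^sub>R v j) = 0"
    using U(1,3) by (simp_all add: sum.reindex[OF inj])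
  have "U (v i) = 0" if "i \<in> I" for i
  proof -
    have "0 = u i \<bullet> (\<Sum>j\<in>I. U (v j) *\<^sub>R v j)"
      by (simp add: comb0)
    also have "\<dots> = (\<Sum>j\<in>I. U (v j) * ((if i = j then 1 else 0) + c i))"
      using that by (simp add: inner_sum_right inner)
    also have "\<dots> = (\<Sum>j\<in>I. if i = j then U (v j) else 0) + (\<Sum>j\<in>I. U (v j)) * c i"
      unfolding sum_distrib_right sum.distrib[symmetric]
      by (intro sum.cong) (auto simp: algebra_simps)
    also have "\<dots> = U (v i)"
      using \<open>finite I\<close> that by (simp add: sum0)
    finally show ?thesis by simp
  qed
  with U(2) show False by auto
qed

theorem proposition1:
  fixes n :: nat
  assumes "n > CARD('d::finite) + 1"
  shows "\<exists>(WQ_rel :: real^'d^'d) (WK_rel :: real^'d^'d) (b :: int \<Rightarrow> real).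
           \<not> (\<exists>(WQ_van :: real^'d^'d) (WK_van :: real^'d^'d) (x :: nat \<Rightarrow> real^'d).
                \<forall>i\<in>{1..n}. \<forall>j\<in>{1..n}.
                  attention_weight n (alpha_rel WQ_rel WK_rel b x) i j =
                  attention_weight n (alpha_vanilla WQ_van WK_van x) i j)"
proof (intro exI notI)
  \<comment> \<open>With zero weight matrices the relative scores form the identity matrix whatever
    \<open>x\<close> is, so one choice of \<open>b\<close> defeats all inputs.\<close>
  let ?b = "\<lambda>k::int. if k = 0 then 1 else 0 :: real"
  assume "\<exists>(WQ :: real^'d^'d) (WK :: real^'d^'d) x. \<forall>i\<in>{1..n}. \<forall>j\<in>{1..n}.
    attention_weight n (alpha_rel (0 :: real^'d^'d) (0 :: real^'d^'d) ?b x) i j =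
    attention_weight n (alpha_vanilla WQ WK x) i j"
  then obtain WQ WK :: "real^'d^'d" and x where eq: "\<And>i j. i \<in> {1..n} \<Longrightarrow> j \<in> {1..n} \<Longrightarrow>
    attention_weight n (alpha_rel (0 :: real^'d^'d) (0 :: real^'d^'d) ?b x) i j =
    attention_weight n (alpha_vanilla WQ WK x) i j"
    by blast
  have rel: "alpha_rel (0 :: real^'d^'d) (0 :: real^'d^'d) ?b x i j = (if i = j then 1 else 0)"
    for i j
    by (simp add: alpha_rel_def)
  have "\<exists>c. \<forall>j\<in>{1..n}. alpha_vanilla WQ WK x i j = (if i = j then 1 else 0) + c"
    if i: "i \<in> {1..n}" for i
  proof -
    have "n > 0" using assms by simp
    then obtain c where "\<And>j. j \<in> {1..n} \<Longrightarrow> alpha_vanilla WQ WK x i j =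
        alpha_rel (0 :: real^'d^'d) (0 :: real^'d^'d) ?b x i j + c"
      using attention_weight_eq_imp_row_shift[OF _ eq[OF i]] by blast
    then show ?thesis unfolding rel by blast
  qed
  then obtain c where c: "\<And>i j. i \<in> {1..n} \<Longrightarrow> j \<in> {1..n} \<Longrightarrow>
      alpha_vanilla WQ WK x i j = (if i = j then 1 else 0) + c i"
    by metis
  have "card {1..n} \<le> DIM(real^'d) + 1"
  proof (rule card_le_of_inner_eq_delta_plus_row_shift)
    fix i j assume "i \<in> {1..n}" "j \<in> {1..n}"
    \<comment> \<open>The scaling factor is absorbed into the query vector, so that the inner
      product is exactly the score.\<close>
    then show "((1 / sqrt (real CARD('d))) *\<^sub>R (x i v* WQ)) \<bullet> (x j v* WK) =
        (if i = j then 1 else 0) + c i"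
      using c[of i j] by (simp add: alpha_vanilla_def)
  qed simp
  with assms show False by simp
qed

end
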